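(* Let $\Gamma=\Gamma_0\star_Z\Gamma_1$ be an amalgamated product, where $\Gamma_0$ is an infinite abelian group and $Z$ is a finite subgroup of $\Gamma_0$ and of $\Gamma_1$. If $\Gamma_1\neq Z$, then the pair $(\Gamma,\Gamma_0)$ satisfies condition (ST).
   Context: For a group $\Gamma$ with an abelian subgroup $\Gamma_0$, the pair $(\Gamma,\Gamma_0)$ satisfies condition (ST) if for every finite subset $C\subset\Gamma\setminus\Gamma_0$ there exists a finite subset $E\subset\Gamma_0$ such that $gg_0h\notin\Gamma_0$ for all $g_0\in\Gamma_0\setminus E$ and all $g,h\in C$. *)

theory Defs
  imports "HOL-Algebra.Algebra"
begin

section \<open>Amalgamated products\<close>

text \<open>
  The amalgamated product of \<open>G0\<close> and \<open>G1\<close> over \<open>Z\<close>, for embeddings \<open>i0\<close> and \<open>i1\<close> of \<open>Z\<close>, is the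
  free product of \<open>G0\<close> and \<open>G1\<close> modulo the identifications \<open>i0 z = i1 z\<close>. It is presented here as
  the monoid of words over the disjoint union of the two groups modulo the congruence generated
  by the multiplication tables of \<open>G0\<close> and \<open>G1\<close> and these identifications. Inverses of letters are
  letters, so no formal inverses are needed.
\<close>

definition amalg_words ::
    "('a, 'm) monoid_scheme \<Rightarrow> ('b, 'n) monoid_scheme \<Rightarrow> ('a + 'b) list set" where
  "amalg_words G0 G1 = lists (carrier G0 <+> carrier G1)"

inductive_set amalg_rel ::
    "('a, 'm) monoid_scheme \<Rightarrow> ('b, 'n) monoid_scheme \<Rightarrow> ('z, 'k) monoid_scheme \<Rightarrow>
     ('z \<Rightarrow> 'a) \<Rightarrow> ('z \<Rightarrow> 'b) \<Rightarrow> (('a + 'b) list \<times> ('a + 'b) list) set"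
  for G0 G1 Z i0 i1
  where
    refl: "w \<in> amalg_words G0 G1 \<Longrightarrow> (w, w) \<in> amalg_rel G0 G1 Z i0 i1"
  | sym: "(v, w) \<in> amalg_rel G0 G1 Z i0 i1 \<Longrightarrow> (w, v) \<in> amalg_rel G0 G1 Z i0 i1"
  | trans: "(u, v) \<in> amalg_rel G0 G1 Z i0 i1 \<Longrightarrow> (v, w) \<in> amalg_rel G0 G1 Z i0 i1 \<Longrightarrow>
      (u, w) \<in> amalg_rel G0 G1 Z i0 i1"
  | append: "(v, v') \<in> amalg_rel G0 G1 Z i0 i1 \<Longrightarrow> (w, w') \<in> amalg_rel G0 G1 Z i0 i1 \<Longrightarrow>
      (v @ w, v' @ w') \<in> amalg_rel G0 G1 Z i0 i1"
  | one0: "([Inl \<one>\<^bsub>G0\<^esub>], []) \<in> amalg_rel G0 G1 Z i0 i1"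
  | one1: "([Inr \<one>\<^bsub>G1\<^esub>], []) \<in> amalg_rel G0 G1 Z i0 i1"
  | mult0: "a \<in> carrier G0 \<Longrightarrow> a' \<in> carrier G0 \<Longrightarrow>
      ([Inl a, Inl a'], [Inl (a \<otimes>\<^bsub>G0\<^esub> a')]) \<in> amalg_rel G0 G1 Z i0 i1"
  | mult1: "b \<in> carrier G1 \<Longrightarrow> b' \<in> carrier G1 \<Longrightarrow>
      ([Inr b, Inr b'], [Inr (b \<otimes>\<^bsub>G1\<^esub> b')]) \<in> amalg_rel G0 G1 Z i0 i1"
  | glue: "z \<in> carrier Z \<Longrightarrow> ([Inl (i0 z)], [Inr (i1 z)]) \<in> amalg_rel G0 G1 Z i0 i1"

definition amalg ::
    "('a, 'm) monoid_scheme \<Rightarrow> ('b, 'n) monoid_scheme \<Rightarrow> ('z, 'k) monoid_scheme \<Rightarrow>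
     ('z \<Rightarrow> 'a) \<Rightarrow> ('z \<Rightarrow> 'b) \<Rightarrow> ('a + 'b) list set monoid" where
  "amalg G0 G1 Z i0 i1 =
    \<lparr>carrier = amalg_words G0 G1 // amalg_rel G0 G1 Z i0 i1,
     monoid.mult = (\<lambda>A B. \<Union>v\<in>A. \<Union>w\<in>B. amalg_rel G0 G1 Z i0 i1 `` {v @ w}),
     one = amalg_rel G0 G1 Z i0 i1 `` {[]}\<rparr>"

definition amalg_in0 ::
    "('a, 'm) monoid_scheme \<Rightarrow> ('b, 'n) monoid_scheme \<Rightarrow> ('z, 'k) monoid_scheme \<Rightarrow>
     ('z \<Rightarrow> 'a) \<Rightarrow> ('z \<Rightarrow> 'b) \<Rightarrow> 'a \<Rightarrow> ('a + 'b) list set" where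
  "amalg_in0 G0 G1 Z i0 i1 a = amalg_rel G0 G1 Z i0 i1 `` {[Inl a]}"

definition amalg_in1 ::
    "('a, 'm) monoid_scheme \<Rightarrow> ('b, 'n) monoid_scheme \<Rightarrow> ('z, 'k) monoid_scheme \<Rightarrow>
     ('z \<Rightarrow> 'a) \<Rightarrow> ('z \<Rightarrow> 'b) \<Rightarrow> 'b \<Rightarrow> ('a + 'b) list set" where
  "amalg_in1 G0 G1 Z i0 i1 b = amalg_rel G0 G1 Z i0 i1 `` {[Inr b]}"


section \<open>Condition (ST)\<close>

text \<open>Only meant for a group \<open>G\<close> and (the carrier of) an abelian subgroup \<open>H\<close> of \<open>G\<close>.\<close>

definition condition_ST :: "('a, 'm) monoid_scheme \<Rightarrow> 'a set \<Rightarrow> bool" where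
  "condition_ST G H \<longleftrightarrow>
    (\<forall>C. finite C \<and> C \<subseteq> carrier G - H \<longrightarrow>
      (\<exists>E. finite E \<and> E \<subseteq> H \<and>
        (\<forall>g0 \<in> H - E. \<forall>g \<in> C. \<forall>h \<in> C. g \<otimes>\<^bsub>G\<^esub> g0 \<otimes>\<^bsub>G\<^esub> h \<notin> H)))"


section \<open>The amalgamated product is a group with the expected universal property\<close>

lemma (in group) ex_equivariant_projection:
  assumes "group Z" and "i \<in> mon Z G"
  obtains p where "\<And>x. x \<in> carrier G \<Longrightarrow> p x \<in> carrier Z"
    and "\<And>z x. z \<in> carrier Z \<Longrightarrow> x \<in> carrier G \<Longrightarrow> p (i z \<otimes> x) = z \<otimes>\<^bsub>Z\<^esub> p x"
proof -
  interpret Z: group Z by fact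
  have hom: "i \<in> hom Z G" and inj: "inj_on i (carrier Z)"
    using assms(2) by (auto simp: mon_def)
  interpret i: group_hom Z G i
    by unfold_locales (rule hom)
  define t where "t x = (SOME y. y \<in> carrier G \<and> (\<exists>z\<in>carrier Z. x = i z \<otimes> y))" for x
  define p where "p x = (SOME z. z \<in> carrier Z \<and> x = i z \<otimes> t x)" for x
  have t: "t x \<in> carrier G \<and> (\<exists>z\<in>carrier Z. x = i z \<otimes> t x)" if "x \<in> carrier G" for x
    unfolding t_def
    by (rule someI[of _ x]) (use that in \<open>auto intro!: bexI[of _ "\<one>\<^bsub>Z\<^esub>"]\<close>)
  have p: "p x \<in> carrier Z \<and> x = i (p x) \<otimes> t x" if "x \<in> carrier G" for x
    unfolding p_def by (rule someI_ex) (use t[OF that] in blast)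
  have t_eq: "t (i z \<otimes> x) = t x" if z: "z \<in> carrier Z" and x: "x \<in> carrier G" for z x
  proof -
    have "(\<exists>z'\<in>carrier Z. i z \<otimes> x = i z' \<otimes> y) \<longleftrightarrow> (\<exists>z'\<in>carrier Z. x = i z' \<otimes> y)"
      if y: "y \<in> carrier G" for y
    proof
      assume "\<exists>z'\<in>carrier Z. i z \<otimes> x = i z' \<otimes> y"
      then obtain z' where z': "z' \<in> carrier Z" "i z \<otimes> x = i z' \<otimes> y" by blast
      have "x = inv (i z) \<otimes> (i z \<otimes> x)" using z x by (simp add: m_assoc[symmetric])
      also have "\<dots> = i (inv\<^bsub>Z\<^esub> z \<otimes>\<^bsub>Z\<^esub> z') \<otimes> y"
        using z z' y by (simp add: m_assoc)
      finally show "\<exists>z'\<in>carrier Z. x = i z' \<otimes> y" using z z' by blast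
    next
      assume "\<exists>z'\<in>carrier Z. x = i z' \<otimes> y"
      then obtain z' where z': "z' \<in> carrier Z" "x = i z' \<otimes> y" by blast
      then have "i z \<otimes> x = i (z \<otimes>\<^bsub>Z\<^esub> z') \<otimes> y" using z y by (simp add: m_assoc)
      then show "\<exists>z'\<in>carrier Z. i z \<otimes> x = i z' \<otimes> y" using z z' by blast
    qed
    then show ?thesis unfolding t_def by (metis (no_types, lifting))
  qed
  show ?thesis
  proof
    show "p x \<in> carrier Z" if "x \<in> carrier G" for x using p[OF that] by simp
    show "p (i z \<otimes> x) = z \<otimes>\<^bsub>Z\<^esub> p x" if z: "z \<in> carrier Z" and x: "x \<in> carrier G" for z x
    proof -
      have px: "p x \<in> carrier Z" "x = i (p x) \<otimes> t x" and tx: "t x \<in> carrier G"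
        using p[OF x] t[OF x] by auto
      have zx: "i z \<otimes> x \<in> carrier G" using z x by simp
      have pz: "p (i z \<otimes> x) \<in> carrier Z" using p[OF zx] by simp
      have "i (p (i z \<otimes> x)) \<otimes> t x = i z \<otimes> x"
        using p[OF zx] t_eq[OF z x] by simp
      also have "\<dots> = i z \<otimes> (i (p x) \<otimes> t x)" using px by simp
      also have "\<dots> = i (z \<otimes>\<^bsub>Z\<^esub> p x) \<otimes> t x" using z px tx by (simp add: m_assoc)
      finally have "i (p (i z \<otimes> x)) = i (z \<otimes>\<^bsub>Z\<^esub> p x)"
        using z px(1) pz tx by simp
      then show ?thesis using inj z px(1) pz by (simp add: inj_on_eq_iff del: i.hom_mult)
    qed
  qed
qed

locale amalg_data =
  G0: group G0 + G1: group G1 + Z: group Z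
  for G0 :: "('a, 'm) monoid_scheme" and G1 :: "('b, 'n) monoid_scheme"
    and Z :: "('z, 'k) monoid_scheme" +
  fixes i0 :: "'z \<Rightarrow> 'a" and i1 :: "'z \<Rightarrow> 'b"
  assumes mon0: "i0 \<in> mon Z G0" and mon1: "i1 \<in> mon Z G1"
begin

abbreviation "W \<equiv> amalg_words G0 G1"
abbreviation "R \<equiv> amalg_rel G0 G1 Z i0 i1"
abbreviation "P \<equiv> amalg G0 G1 Z i0 i1"
abbreviation "in0 \<equiv> amalg_in0 G0 G1 Z i0 i1"
abbreviation "in1 \<equiv> amalg_in1 G0 G1 Z i0 i1"

sublocale i0: group_hom Z G0 i0
  by unfold_locales (use mon0 in \<open>simp add: mon_def\<close>)

sublocale i1: group_hom Z G1 i1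
  by unfold_locales (use mon1 in \<open>simp add: mon_def\<close>)

lemma words_simps [simp]:
  "[] \<in> W" "Inl a # w \<in> W \<longleftrightarrow> a \<in> carrier G0 \<and> w \<in> W"
  "Inr b # w \<in> W \<longleftrightarrow> b \<in> carrier G1 \<and> w \<in> W" "v @ w \<in> W \<longleftrightarrow> v \<in> W \<and> w \<in> W"
  by (auto simp: amalg_words_def)

lemma rel_words: "(v, w) \<in> R \<Longrightarrow> v \<in> W \<and> w \<in> W"
  by (induction rule: amalg_rel.induct) auto

lemma equiv_rel: "equiv W R"
  by (rule equivI)
    (auto simp: refl_on_def sym_def trans_def dest: rel_words intro: amalg_rel.intros)

lemma class_eq: "(v, w) \<in> R \<Longrightarrow> R `` {v} = R `` {w}"
  using equiv_class_eq[OF equiv_rel] .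

lemma append_respects: "(\<lambda>v w. R `` {v @ w}) respects2 R"
  by (rule congruent2I') (rule class_eq, rule amalg_rel.append)

lemma carrier_P: "carrier P = W // R"
  and one_P: "\<one>\<^bsub>P\<^esub> = R `` {[]}"
  by (simp_all add: amalg_def)

lemma class_in_P: "w \<in> W \<Longrightarrow> R `` {w} \<in> carrier P"
  by (simp add: carrier_P quotientI)

lemma mult_P: "v \<in> W \<Longrightarrow> w \<in> W \<Longrightarrow> R `` {v} \<otimes>\<^bsub>P\<^esub> R `` {w} = R `` {v @ w}"
  using UN_equiv_class2[OF equiv_rel equiv_rel append_respects] by (simp add: amalg_def)

lemma P_cases:
  assumes "A \<in> carrier P"
  obtains w where "w \<in> W" "A = R `` {w}"
  using assms by (auto simp: carrier_P elim: quotientE)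

lemma rel_inverse:
  assumes "w \<in> W"
  shows "\<exists>v\<in>W. (v @ w, []) \<in> R"
  using assms
proof (induction w)
  case Nil
  then show ?case by (auto intro!: bexI[of _ "[]"] amalg_rel.refl)
next
  case (Cons x w)
  have w: "w \<in> W" using Cons.prems by (cases x) auto
  with Cons.IH obtain v where v: "v \<in> W" "(v @ w, []) \<in> R" by blast
  obtain y where y: "[y] \<in> W" "([y, x], []) \<in> R"
  proof (cases x)
    case (Inl a)
    then have a: "a \<in> carrier G0" using Cons.prems by simp
    have "([Inl (inv\<^bsub>G0\<^esub> a), Inl a], [Inl \<one>\<^bsub>G0\<^esub>]) \<in> R"
      using amalg_rel.mult0[of "inv\<^bsub>G0\<^esub> a" G0 a] a by simp
    then show ?thesis using that[of "Inl (inv\<^bsub>G0\<^esub> a)"] a Inl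
      by (auto intro: amalg_rel.trans amalg_rel.one0)
  next
    case (Inr b)
    then have b: "b \<in> carrier G1" using Cons.prems by simp
    have "([Inr (inv\<^bsub>G1\<^esub> b), Inr b], [Inr \<one>\<^bsub>G1\<^esub>]) \<in> R"
      using amalg_rel.mult1[of "inv\<^bsub>G1\<^esub> b" G1 b] b by simp
    then show ?thesis using that[of "Inr (inv\<^bsub>G1\<^esub> b)"] b Inr
      by (auto intro: amalg_rel.trans amalg_rel.one1)
  qed
  have "(v @ ([y, x] @ w), v @ ([] @ w)) \<in> R"
    by (intro amalg_rel.append amalg_rel.refl v y w)
  then have "((v @ [y]) @ x # w, []) \<in> R"
    using v(2) by (auto intro: amalg_rel.trans)
  moreover have "v @ [y] \<in> W" using v y by simp
  ultimately show ?case by blast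
qed

lemma group_P: "group P"
proof (rule groupI)
  show "A \<otimes>\<^bsub>P\<^esub> B \<in> carrier P" if "A \<in> carrier P" "B \<in> carrier P" for A B
    using that by (auto elim!: P_cases simp: mult_P intro!: class_in_P)
  show "\<one>\<^bsub>P\<^esub> \<in> carrier P" by (simp add: one_P class_in_P)
  show "A \<otimes>\<^bsub>P\<^esub> B \<otimes>\<^bsub>P\<^esub> C = A \<otimes>\<^bsub>P\<^esub> (B \<otimes>\<^bsub>P\<^esub> C)"
    if "A \<in> carrier P" "B \<in> carrier P" "C \<in> carrier P" for A B C
    using that by (auto elim!: P_cases simp: mult_P)
  show "\<one>\<^bsub>P\<^esub> \<otimes>\<^bsub>P\<^esub> A = A" if "A \<in> carrier P" for A
    using that by (auto elim!: P_cases simp: mult_P one_P)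
  show "\<exists>B\<in>carrier P. B \<otimes>\<^bsub>P\<^esub> A = \<one>\<^bsub>P\<^esub>" if A: "A \<in> carrier P" for A
  proof -
    obtain w where w: "w \<in> W" "A = R `` {w}" using A by (rule P_cases)
    obtain v where v: "v \<in> W" "(v @ w, []) \<in> R" using rel_inverse[OF w(1)] by blast
    show ?thesis
      by (rule bexI[of _ "R `` {v}"])
        (use v w in \<open>auto simp: mult_P one_P class_in_P dest: class_eq\<close>)
  qed
qed

lemma in0_hom: "in0 \<in> hom G0 P"
  by (rule homI) (auto simp: amalg_in0_def class_in_P mult_P
      intro!: class_eq amalg_rel.sym[OF amalg_rel.mult0])

lemma in1_hom: "in1 \<in> hom G1 P"
  by (rule homI) (auto simp: amalg_in1_def class_in_P mult_P
      intro!: class_eq amalg_rel.sym[OF amalg_rel.mult1])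

lemma in0_eq_in1: "z \<in> carrier Z \<Longrightarrow> in0 (i0 z) = in1 (i1 z)"
  by (auto simp: amalg_in0_def amalg_in1_def intro!: class_eq amalg_rel.glue)

theorem universal_property:
  assumes H: "group H" and f0: "f0 \<in> hom G0 H" and f1: "f1 \<in> hom G1 H"
    and agree: "\<And>z. z \<in> carrier Z \<Longrightarrow> f0 (i0 z) = f1 (i1 z)"
  shows "\<exists>h\<in>hom P H. (\<forall>a\<in>carrier G0. h (in0 a) = f0 a) \<and> (\<forall>b\<in>carrier G1. h (in1 b) = f1 b)"
proof -
  interpret H: group H by fact
  interpret f0: group_hom G0 H f0 by unfold_locales fact
  interpret f1: group_hom G1 H f1 by unfold_locales fact
  define ev where "ev w = foldr (\<lambda>x y. case_sum f0 f1 x \<otimes>\<^bsub>H\<^esub> y) w \<one>\<^bsub>H\<^esub>" for w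
  have ev_simps [simp]: "ev [] = \<one>\<^bsub>H\<^esub>" "ev (Inl a # w) = f0 a \<otimes>\<^bsub>H\<^esub> ev w"
    "ev (Inr b # w) = f1 b \<otimes>\<^bsub>H\<^esub> ev w" for a b w
    by (simp_all add: ev_def)
  have ev_closed [simp]: "ev w \<in> carrier H" if "w \<in> W" for w
    using that
  proof (induction w)
    case (Cons x w)
    then show ?case by (cases x) auto
  qed simp
  have ev_append: "ev (v @ w) = ev v \<otimes>\<^bsub>H\<^esub> ev w" if "v \<in> W" "w \<in> W" for v w
    using that
  proof (induction v)
    case (Cons x v)
    then show ?case by (cases x) (auto simp: H.m_assoc)
  qed simp
  have ev_rel: "ev v = ev w" if "(v, w) \<in> R" for v w
    using that
  proof (induction rule: amalg_rel.induct)
    case (append v v' w w')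
    then show ?case by (auto simp: ev_append dest!: rel_words)
  qed (auto simp: agree)
  define h where "h A = the_elem (ev ` A)" for A
  have h_class: "h (R `` {w}) = ev w" if "w \<in> W" for w
  proof -
    have "ev ` (R `` {w}) = {ev w}"
      using that by (auto simp: image_iff intro: amalg_rel.refl dest: ev_rel)
    then show ?thesis by (simp add: h_def)
  qed
  have "h \<in> hom P H"
    by (rule homI) (auto elim!: P_cases simp: mult_P h_class ev_append)
  moreover have "h (in0 a) = f0 a" if "a \<in> carrier G0" for a
    using that by (simp add: amalg_in0_def h_class)
  moreover have "h (in1 b) = f1 b" if "b \<in> carrier G1" for b
    using that by (simp add: amalg_in1_def h_class)
  ultimately show ?thesis by blast
qed

theorem universal_property_unique:
  assumes H: "group H" and h: "h \<in> hom P H" and k: "k \<in> hom P H"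
    and eq0: "\<And>a. a \<in> carrier G0 \<Longrightarrow> h (in0 a) = k (in0 a)"
    and eq1: "\<And>b. b \<in> carrier G1 \<Longrightarrow> h (in1 b) = k (in1 b)"
    and A: "A \<in> carrier P"
  shows "h A = k A"
proof -
  interpret h: group_hom P H h using group_P H h by (intro group_hom.intro group_hom_axioms.intro)
  interpret k: group_hom P H k using group_P H k by (intro group_hom.intro group_hom_axioms.intro)
  have "h (R `` {w}) = k (R `` {w})" if "w \<in> W" for w
    using that
  proof (induction w)
    case Nil
    show ?case using h.hom_one k.hom_one by (simp add: one_P)
  next
    case (Cons x w)
    have x: "[x] \<in> W" and w: "w \<in> W" using Cons.prems by (cases x; simp)+
    have "h (R `` {[x]}) = k (R `` {[x]})"
      using x by (cases x) (auto simp: eq0[unfolded amalg_in0_def] eq1[unfolded amalg_in1_def])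
    moreover have "R `` {x # w} = R `` {[x]} \<otimes>\<^bsub>P\<^esub> R `` {w}"
      using x w by (simp add: mult_P)
    ultimately show ?case
      using Cons.IH[OF w] x w by (simp add: class_in_P)
  qed
  with A show ?thesis by (auto elim: P_cases)
qed

text \<open>
  Injectivity of the canonical maps: both factors act faithfully on \<open>carrier G0 \<times> carrier G1\<close>,
  with actions that agree on \<open>Z\<close>.
\<close>

theorem in0_in1_mon: "in0 \<in> mon G0 P" "in1 \<in> mon G1 P"
proof -
  obtain p0 where p0: "\<And>x. x \<in> carrier G0 \<Longrightarrow> p0 x \<in> carrier Z"
    "\<And>z x. z \<in> carrier Z \<Longrightarrow> x \<in> carrier G0 \<Longrightarrow> p0 (i0 z \<otimes>\<^bsub>G0\<^esub> x) = z \<otimes>\<^bsub>Z\<^esub> p0 x"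
    using G0.ex_equivariant_projection[OF Z.group_axioms mon0] by blast
  obtain p1 where p1: "\<And>y. y \<in> carrier G1 \<Longrightarrow> p1 y \<in> carrier Z"
    "\<And>z y. z \<in> carrier Z \<Longrightarrow> y \<in> carrier G1 \<Longrightarrow> p1 (i1 z \<otimes>\<^bsub>G1\<^esub> y) = z \<otimes>\<^bsub>Z\<^esub> p1 y"
    using G1.ex_equivariant_projection[OF Z.group_axioms mon1] by blast
  define t0 where "t0 x = i0 (inv\<^bsub>Z\<^esub> p0 x) \<otimes>\<^bsub>G0\<^esub> x" for x
  define t1 where "t1 y = i1 (inv\<^bsub>Z\<^esub> p1 y) \<otimes>\<^bsub>G1\<^esub> y" for y
  have t0: "t0 x \<in> carrier G0" "p0 (t0 x) = \<one>\<^bsub>Z\<^esub>" "i0 (p0 x) \<otimes>\<^bsub>G0\<^esub> t0 x = x"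
    if "x \<in> carrier G0" for x
    using that p0(1)[OF that]
    by (simp_all add: t0_def p0(2) G0.m_assoc[symmetric] del: i0.hom_inv)
       (simp add: i0.hom_mult[symmetric] del: i0.hom_inv i0.hom_mult)
  have t1: "t1 y \<in> carrier G1" "p1 (t1 y) = \<one>\<^bsub>Z\<^esub>" "i1 (p1 y) \<otimes>\<^bsub>G1\<^esub> t1 y = y"
    if "y \<in> carrier G1" for y
    using that p1(1)[OF that]
    by (simp_all add: t1_def p1(2) G1.m_assoc[symmetric] del: i1.hom_inv)
       (simp add: i1.hom_mult[symmetric] del: i1.hom_inv i1.hom_mult)
  have t0_z: "t0 (i0 z \<otimes>\<^bsub>G0\<^esub> x) = t0 x" if z: "z \<in> carrier Z" and x: "x \<in> carrier G0" for z x
  proof -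
    have "t0 (i0 z \<otimes>\<^bsub>G0\<^esub> x) = i0 (inv\<^bsub>Z\<^esub> (z \<otimes>\<^bsub>Z\<^esub> p0 x) \<otimes>\<^bsub>Z\<^esub> z) \<otimes>\<^bsub>G0\<^esub> x"
      using z x p0(1)[OF x] by (simp add: t0_def p0(2) G0.m_assoc del: i0.hom_inv)
    also have "inv\<^bsub>Z\<^esub> (z \<otimes>\<^bsub>Z\<^esub> p0 x) \<otimes>\<^bsub>Z\<^esub> z = inv\<^bsub>Z\<^esub> p0 x"
      using z p0(1)[OF x] by (simp add: Z.inv_mult_group Z.m_assoc)
    finally show ?thesis by (simp add: t0_def)
  qed
  have t1_z: "t1 (i1 z \<otimes>\<^bsub>G1\<^esub> y) = t1 y" if z: "z \<in> carrier Z" and y: "y \<in> carrier G1" for z y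
  proof -
    have "t1 (i1 z \<otimes>\<^bsub>G1\<^esub> y) = i1 (inv\<^bsub>Z\<^esub> (z \<otimes>\<^bsub>Z\<^esub> p1 y) \<otimes>\<^bsub>Z\<^esub> z) \<otimes>\<^bsub>G1\<^esub> y"
      using z y p1(1)[OF y] by (simp add: t1_def p1(2) G1.m_assoc del: i1.hom_inv)
    also have "inv\<^bsub>Z\<^esub> (z \<otimes>\<^bsub>Z\<^esub> p1 y) \<otimes>\<^bsub>Z\<^esub> z = inv\<^bsub>Z\<^esub> p1 y"
      using z p1(1)[OF y] by (simp add: Z.inv_mult_group Z.m_assoc)
    finally show ?thesis by (simp add: t1_def)
  qed
  have t0_t0: "t0 (t0 x) = t0 x" if "x \<in> carrier G0" for x
    using t0_z[of "inv\<^bsub>Z\<^esub> p0 x" x] p0(1)[OF that] that by (simp add: t0_def)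
  have t1_t1: "t1 (t1 y) = t1 y" if "y \<in> carrier G1" for y
    using t1_z[of "inv\<^bsub>Z\<^esub> p1 y" y] p1(1)[OF that] that by (simp add: t1_def)

  define S where "S = carrier G0 \<times> carrier G1"
  define sw where "sw = (\<lambda>(x, y). (i0 (p1 y) \<otimes>\<^bsub>G0\<^esub> t0 x, i1 (p0 x) \<otimes>\<^bsub>G1\<^esub> t1 y))"
  have sw_S: "sw q \<in> S" if "q \<in> S" for q
    using that by (auto simp: S_def sw_def p0 p1 t0 t1)
  have sw_sw: "sw (sw q) = q" if "q \<in> S" for q
    using that by (auto simp: S_def sw_def p0 p1 t0 t1 t0_z t1_z t0_t0 t1_t1)
  have sw_z: "sw (i0 z \<otimes>\<^bsub>G0\<^esub> x, y) = (fst (sw (x, y)), i1 z \<otimes>\<^bsub>G1\<^esub> snd (sw (x, y)))"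
    if "z \<in> carrier Z" "x \<in> carrier G0" "y \<in> carrier G1" for z x y
    using that by (auto simp: sw_def p0 p1 t0 t1 t0_z t1_z G1.m_assoc)

  define g0 where "g0 a q = (a \<otimes>\<^bsub>G0\<^esub> fst q, snd q)" for a and q :: "'a \<times> 'b"
  define g1 where "g1 b q = sw (fst (sw q), b \<otimes>\<^bsub>G1\<^esub> snd (sw q))" for b q
  have g0_S: "g0 a q \<in> S" if "a \<in> carrier G0" "q \<in> S" for a q
    using that by (auto simp: g0_def S_def)
  have g1_S: "g1 b q \<in> S" if "b \<in> carrier G1" "q \<in> S" for b q
    using that sw_S[of q] by (auto simp: g1_def S_def intro!: sw_S[unfolded S_def])
  have g0_mult: "g0 (a \<otimes>\<^bsub>G0\<^esub> a') q = g0 a (g0 a' q)"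
    if "a \<in> carrier G0" "a' \<in> carrier G0" "q \<in> S" for a a' q
    using that by (auto simp: g0_def S_def G0.m_assoc)
  have g1_mult: "g1 (b \<otimes>\<^bsub>G1\<^esub> b') q = g1 b (g1 b' q)"
    if "b \<in> carrier G1" "b' \<in> carrier G1" "q \<in> S" for b b' q
  proof -
    have q: "fst (sw q) \<in> carrier G0" "snd (sw q) \<in> carrier G1"
      using sw_S[OF that(3)] by (auto simp: S_def)
    then have "(fst (sw q), b' \<otimes>\<^bsub>G1\<^esub> snd (sw q)) \<in> S" using that by (simp add: S_def)
    with q that show ?thesis by (simp add: g1_def sw_sw G1.m_assoc)
  qed
  have g0_one: "g0 \<one>\<^bsub>G0\<^esub> q = q" if "q \<in> S" for q
    using that by (auto simp: g0_def S_def)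
  have g1_one: "g1 \<one>\<^bsub>G1\<^esub> q = q" if "q \<in> S" for q
    using that sw_S[OF that] sw_sw[OF that] by (auto simp: g1_def S_def)
  have action: "(\<lambda>a. restrict (g a) S) \<in> hom K (BijGroup S)"
    if K: "group K"
      and gS: "\<And>a q. a \<in> carrier K \<Longrightarrow> q \<in> S \<Longrightarrow> g a q \<in> S"
      and gm: "\<And>a a' q. a \<in> carrier K \<Longrightarrow> a' \<in> carrier K \<Longrightarrow> q \<in> S \<Longrightarrow> g (a \<otimes>\<^bsub>K\<^esub> a') q = g a (g a' q)"
      and g1: "\<And>q. q \<in> S \<Longrightarrow> g \<one>\<^bsub>K\<^esub> q = q"
    for K :: "('c, 'd) monoid_scheme" and g
  proof -
    interpret K: group K by fact
    have Bij: "restrict (g a) S \<in> Bij S" if a: "a \<in> carrier K" for a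
    proof -
      have "bij_betw (g a) S S"
      proof (rule bij_betw_byWitness[where f' = "g (inv\<^bsub>K\<^esub> a)"])
        show "\<forall>q\<in>S. g (inv\<^bsub>K\<^esub> a) (g a q) = q"
          using a by (simp add: gm[symmetric] g1)
        show "\<forall>q\<in>S. g a (g (inv\<^bsub>K\<^esub> a) q) = q"
          using a by (simp add: gm[symmetric] g1)
      qed (use a gS in auto)
      then show ?thesis by (simp add: Bij_def bij_betw_restrict_eq)
    qed
    show ?thesis
    proof (rule homI)
      show "restrict (g a) S \<in> carrier (BijGroup S)" if "a \<in> carrier K" for a
        using Bij[OF that] by (simp add: BijGroup_def)
      show "restrict (g (a \<otimes>\<^bsub>K\<^esub> a')) S = restrict (g a) S \<otimes>\<^bsub>BijGroup S\<^esub> restrict (g a') S"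
        if "a \<in> carrier K" "a' \<in> carrier K" for a a'
        using that by (auto simp: BijGroup_def Bij compose_def gm gS intro!: restrict_ext)
    qed
  qed
  define f0 where "f0 a = restrict (g0 a) S" for a
  define f1 where "f1 b = restrict (g1 b) S" for b
  have f0: "f0 \<in> hom G0 (BijGroup S)"
    using action[OF G0.group_axioms g0_S g0_mult g0_one] by (simp add: f0_def[abs_def])
  have f1: "f1 \<in> hom G1 (BijGroup S)"
    using action[OF G1.group_axioms g1_S g1_mult g1_one] by (simp add: f1_def[abs_def])
  have agree: "f0 (i0 z) = f1 (i1 z)" if z: "z \<in> carrier Z" for z
    unfolding f0_def f1_def
  proof (rule restrict_ext)
    fix q assume q: "q \<in> S"
    have "g1 (i1 z) q = sw (sw (i0 z \<otimes>\<^bsub>G0\<^esub> fst q, snd q))"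
      using z q by (auto simp: g1_def sw_z S_def)
    also have "\<dots> = g0 (i0 z) q"
      using z q by (subst sw_sw) (auto simp: g0_def S_def)
    finally show "g0 (i0 z) q = g1 (i1 z) q" by simp
  qed
  obtain h where h: "\<And>a. a \<in> carrier G0 \<Longrightarrow> h (in0 a) = f0 a"
    "\<And>b. b \<in> carrier G1 \<Longrightarrow> h (in1 b) = f1 b"
    using universal_property[OF group_BijGroup f0 f1 agree] by blast
  have one_S: "(\<one>\<^bsub>G0\<^esub>, \<one>\<^bsub>G1\<^esub>) \<in> S" by (simp add: S_def)
  have "inj_on in0 (carrier G0)"
  proof (rule inj_onI)
    fix a a' assume a: "a \<in> carrier G0" "a' \<in> carrier G0" and "in0 a = in0 a'"
    then have "f0 a = f0 a'" using h(1) by metis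
    from fun_cong[OF this, of "(\<one>\<^bsub>G0\<^esub>, \<one>\<^bsub>G1\<^esub>)"] show "a = a'"
      using a one_S by (simp add: f0_def g0_def)
  qed
  moreover have "inj_on in1 (carrier G1)"
  proof (rule inj_onI)
    fix b b' assume b: "b \<in> carrier G1" "b' \<in> carrier G1" and "in1 b = in1 b'"
    then have "f1 b = f1 b'" using h(2) by metis
    from fun_cong[OF this, of "sw (\<one>\<^bsub>G0\<^esub>, \<one>\<^bsub>G1\<^esub>)"]
    have "sw (\<one>\<^bsub>G0\<^esub>, b) = sw (\<one>\<^bsub>G0\<^esub>, b')"
      using b one_S sw_S[OF one_S] by (simp add: f1_def g1_def sw_sw)
    then have "sw (sw (\<one>\<^bsub>G0\<^esub>, b)) = sw (sw (\<one>\<^bsub>G0\<^esub>, b'))" by simp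
    then show "b = b'" using b by (simp add: sw_sw S_def)
  qed
  ultimately show "in0 \<in> mon G0 P" "in1 \<in> mon G1 P"
    using in0_hom in1_hom by (auto simp: mon_def)
qed

lemma subgroup_in0: "subgroup (in0 ` carrier G0) P"
proof -
  interpret group_hom G0 P in0
    using group_P in0_hom G0.group_axioms by (intro group_hom.intro group_hom_axioms.intro)
  show ?thesis by (rule img_is_subgroup)
qed

end

end

theory Submission
  imports Defs
begin

text \<open>
  An element outside \<open>G0\<close> has, by multiplying out syllables, the form \<open>a u a'\<close> with \<open>a, a'\<close> in
  \<open>G0\<close> and \<open>u\<close> a \<^emph>\<open>core\<close>: a word \<open>b\<^sub>1 a\<^sub>1 b\<^sub>2 a\<^sub>2 \<dots> b\<^sub>n\<close> whose letters lie alternately in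
  \<open>G1\<close> and \<open>G0\<close>, all of them outside \<open>Z\<close> (\<open>has_core_if_notin_in0\<close>). For \<open>g = a u a'\<close> and
  \<open>h = c v c'\<close> this gives \<open>g x h = a u (a' x c) v c'\<close>, and if \<open>a' x c\<close> is not in \<open>Z\<close>, then
  \<open>u (a' x c) v\<close> is again a core. Since no core represents an element of \<open>G0\<close>
  (\<open>core_class_notin_in0\<close>), \<open>g x h\<close> can lie in \<open>G0\<close> only if \<open>x\<close> is in the finite set
  \<open>a'\<inverse> Z c\<inverse>\<close> (\<open>finite_return_set\<close>), and the exceptional set for \<open>C\<close> is the union of these sets
  over all pairs from \<open>C\<close>.

  The substance is that cores stay outside \<open>G0\<close>. This follows van der Waerden: words act on normal
  forms, which are pairs of an element of \<open>Z\<close> and an alternating list of nontrivial coset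
  representatives. A letter outside \<open>Z\<close> moves every normal form not starting with its own factor
  to one that does, so cores play ping-pong and send the trivial normal form to one starting in
  \<open>G1\<close>. Elements of \<open>G0\<close> never do that. The action is built for one factor at a time
  (\<open>normal_form_action\<close>); the two actions agree on \<open>Z\<close>, so related words act equally.
\<close>

section \<open>The action on normal forms\<close>

definition starts_with :: "('k \<Rightarrow> 'x) \<Rightarrow> 'x list \<Rightarrow> bool" where
  "starts_with c l \<longleftrightarrow> l \<noteq> [] \<and> hd l \<in> range c"

lemma starts_with_simps [simp]:
  "\<not> starts_with c []" "starts_with c (x # l) \<longleftrightarrow> x \<in> range c"
  by (simp_all add: starts_with_def)

text \<open>
  An equivariant projection \<open>p\<close> chooses representatives of the cosets \<open>Z x\<close>, namely the solutions
  of \<open>p x = 1\<close>. The normalization makes \<open>1\<close> the representative of \<open>Z\<close> itself, so that the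
  nontrivial representatives are exactly those outside \<open>Z\<close>.
\<close>

lemma (in group) ex_normalized_projection:
  assumes Z: "group Z" and i: "i \<in> mon Z G"
  obtains p where "\<And>x. x \<in> carrier G \<Longrightarrow> p x \<in> carrier Z"
    and "\<And>z x. z \<in> carrier Z \<Longrightarrow> x \<in> carrier G \<Longrightarrow> p (i z \<otimes> x) = z \<otimes>\<^bsub>Z\<^esub> p x"
    and "p \<one> = \<one>\<^bsub>Z\<^esub>"
proof -
  interpret Z: group Z by fact
  obtain p where p: "\<And>x. x \<in> carrier G \<Longrightarrow> p x \<in> carrier Z"
    "\<And>z x. z \<in> carrier Z \<Longrightarrow> x \<in> carrier G \<Longrightarrow> p (i z \<otimes> x) = z \<otimes>\<^bsub>Z\<^esub> p x"
    using ex_equivariant_projection[OF Z i] by blast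
  have "i z \<in> carrier G" if "z \<in> carrier Z" for z
    using i that by (auto simp: mon_def hom_def)
  then show ?thesis
    by (intro that[of "\<lambda>x. p x \<otimes>\<^bsub>Z\<^esub> inv\<^bsub>Z\<^esub> p \<one>"]) (simp_all add: p Z.m_assoc)
qed

text \<open>
  One factor \<open>G\<close> of the amalgam acts on normal forms \<open>(z, l)\<close>, where \<open>c\<close> marks its letters and
  \<open>N\<close> is the set of admissible lists; all that matters about the other factor is hidden in \<open>N\<close>.
  Let \<open>M\<close> be the set of lists in \<open>N\<close> that do not start with a letter of \<open>G\<close>. As \<open>G\<close> is the
  disjoint union of the cosets of \<open>Z\<close>, merging \<open>z\<close> with a first letter from \<open>G\<close>, if there is
  one, is a bijection from \<open>Z \<times> N\<close> to \<open>G \<times> M\<close>. The action is left multiplication on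
  \<open>G \<times> M\<close> transported along it, which makes the action laws immediate without a case
  analysis on cancellations.
\<close>

lemma (in group) normal_form_action:
  assumes Z: "group Z" and i: "i \<in> mon Z G"
    and p_closed: "\<And>x. x \<in> carrier G \<Longrightarrow> p x \<in> carrier Z"
    and p_equiv: "\<And>z x. z \<in> carrier Z \<Longrightarrow> x \<in> carrier G \<Longrightarrow> p (i z \<otimes> x) = z \<otimes>\<^bsub>Z\<^esub> p x"
    and p_one: "p \<one> = \<one>\<^bsub>Z\<^esub>"
    and c: "inj c"
    and N: "\<And>t l. c t # l \<in> N \<longleftrightarrow>
      t \<in> carrier G \<and> p t = \<one>\<^bsub>Z\<^esub> \<and> t \<noteq> \<one> \<and> l \<in> N \<and> \<not> starts_with c l"
  obtains g where "\<And>x q. x \<in> carrier G \<Longrightarrow> q \<in> carrier Z \<times> N \<Longrightarrow> g x q \<in> carrier Z \<times> N"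
    and "\<And>x y q. x \<in> carrier G \<Longrightarrow> y \<in> carrier G \<Longrightarrow> q \<in> carrier Z \<times> N \<Longrightarrow>
      g (x \<otimes> y) q = g x (g y q)"
    and "\<And>z y l. z \<in> carrier Z \<Longrightarrow> y \<in> carrier Z \<Longrightarrow> l \<in> N \<Longrightarrow> g (i z) (y, l) = (z \<otimes>\<^bsub>Z\<^esub> y, l)"
    and "\<And>x q. x \<in> carrier G - i ` carrier Z \<Longrightarrow> q \<in> carrier Z \<times> N \<Longrightarrow>
      \<not> starts_with c (snd q) \<Longrightarrow> starts_with c (snd (g x q))"
proof -
  interpret Z: group Z by fact
  interpret i: group_hom Z G i
    by unfold_locales (use i in \<open>simp add: mon_def\<close>)
  define M where "M = {l \<in> N. \<not> starts_with c l}"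
  \<comment> \<open>the representative of the coset of \<open>x\<close>\<close>
  define t where "t x = inv (i (p x)) \<otimes> x" for x
  define unpack where "unpack = (\<lambda>(z, l).
    if starts_with c l then (i z \<otimes> inv_into UNIV c (hd l), tl l) else (i z, l))"
  define pack where "pack = (\<lambda>(x, l). (p x, if t x = \<one> then l else c (t x) # l))"
  have t_closed: "t x \<in> carrier G" if "x \<in> carrier G" for x
    using that p_closed by (simp add: t_def)
  have p_t: "p (t x) = \<one>\<^bsub>Z\<^esub>" if "x \<in> carrier G" for x
    using that p_closed p_equiv[of "inv\<^bsub>Z\<^esub> p x" x] by (simp add: t_def)
  have split: "i (p x) \<otimes> t x = x" if "x \<in> carrier G" for x
    using that p_closed by (simp add: t_def m_assoc[symmetric])
  have t_equiv: "t (i z \<otimes> x) = t x" if "z \<in> carrier Z" "x \<in> carrier G" for z x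
    using that p_closed by (simp add: t_def p_equiv inv_mult_group m_assoc) (simp add: m_assoc[symmetric])
  have t_id: "t x = x" if "x \<in> carrier G" "p x = \<one>\<^bsub>Z\<^esub>" for x
    using that by (simp add: t_def)
  have unpack_closed: "unpack q \<in> carrier G \<times> M" if "q \<in> carrier Z \<times> N" for q
    using that N c by (cases q; cases "snd q") (auto simp: unpack_def M_def)
  have pack_closed: "pack r \<in> carrier Z \<times> N" if "r \<in> carrier G \<times> M" for r
    using that by (auto simp: pack_def M_def N t_closed p_t p_closed)
  have pack_unpack: "pack (unpack q) = q" if q: "q \<in> carrier Z \<times> N" for q
  proof -
    obtain z l where zl: "q = (z, l)" "z \<in> carrier Z" "l \<in> N" using q by auto
    show ?thesis
    proof (cases "starts_with c l")
      case True
      then obtain s l' where "l = c s # l'" by (cases l) auto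
      with zl N[of s l'] c show ?thesis
        by (simp add: unpack_def pack_def p_equiv t_equiv t_id)
    next
      case False
      have "p (i z) = z" "t (i z) = \<one>"
        using zl p_equiv[of z \<one>] t_equiv[of z \<one>] t_id[of \<one>] by (simp_all add: p_one)
      with False zl show ?thesis by (simp add: unpack_def pack_def)
    qed
  qed
  have unpack_pack: "unpack (pack r) = r" if r: "r \<in> carrier G \<times> M" for r
  proof -
    obtain x l where xl: "r = (x, l)" "x \<in> carrier G" "\<not> starts_with c l"
      using r by (auto simp: M_def)
    then show ?thesis
      using split[of x] p_closed[of x] c by (cases "t x = \<one>") (simp_all add: unpack_def pack_def)
  qed
  define g where "g x q = pack (x \<otimes> fst (unpack q), snd (unpack q))" for x q
  have step: "(x \<otimes> fst (unpack q), snd (unpack q)) \<in> carrier G \<times> M"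
    if "x \<in> carrier G" "q \<in> carrier Z \<times> N" for x q
    using unpack_closed[OF that(2)] that by (cases "unpack q") auto
  show ?thesis
  proof (rule that[of g])
    show "g x q \<in> carrier Z \<times> N" if "x \<in> carrier G" "q \<in> carrier Z \<times> N" for x q
      unfolding g_def using step[OF that] by (rule pack_closed)
    show "g (x \<otimes> y) q = g x (g y q)"
      if "x \<in> carrier G" "y \<in> carrier G" "q \<in> carrier Z \<times> N" for x y q
      using that unpack_pack[OF step[of y q]] unpack_closed[of q]
      by (cases "unpack q") (auto simp: g_def m_assoc)
    show "g (i z) (y, l) = (z \<otimes>\<^bsub>Z\<^esub> y, l)"
      if "z \<in> carrier Z" "y \<in> carrier Z" "l \<in> N" for z y l
    proof -
      have q: "(y, l) \<in> carrier Z \<times> N" using that by simp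
      have "pack (unpack (y, l)) = (y, l)" by (rule pack_unpack[OF q])
      then show ?thesis
        using that unpack_closed[OF q]
        by (cases "unpack (y, l)") (auto simp: g_def pack_def p_equiv t_equiv)
    qed
    show "starts_with c (snd (g x q))"
      if x: "x \<in> carrier G - i ` carrier Z" and q: "q \<in> carrier Z \<times> N"
        and l: "\<not> starts_with c (snd q)" for x q
    proof -
      obtain z l where zl: "q = (z, l)" "z \<in> carrier Z" using q by auto
      have "t (x \<otimes> i z) \<noteq> \<one>"
      proof
        assume "t (x \<otimes> i z) = \<one>"
        then have eq: "i (p (x \<otimes> i z)) = x \<otimes> i z"
          using split[of "x \<otimes> i z"] x zl p_closed[of "x \<otimes> i z"] by simp
        have "x = x \<otimes> i z \<otimes> i (inv\<^bsub>Z\<^esub> z)"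
          using x zl by (simp add: m_assoc)
        also have "\<dots> = i (p (x \<otimes> i z) \<otimes>\<^bsub>Z\<^esub> inv\<^bsub>Z\<^esub> z)"
          using x zl p_closed[of "x \<otimes> i z"] by (simp add: eq del: i.hom_inv)
        finally have "x \<in> i ` carrier Z"
          by (rule image_eqI) (use x zl p_closed[of "x \<otimes> i z"] in simp)
        then show False using x by simp
      qed
      then show ?thesis using zl l by (simp add: g_def pack_def unpack_def)
    qed
  qed
qed

section \<open>Core words\<close>

context amalg_data
begin

text \<open>
  A core begins and ends with a letter of \<open>G1\<close>, so that two cores can be joined by any single
  letter of \<open>G0\<close> outside \<open>Z\<close>.
\<close>

inductive_set core :: "('a + 'b) list set" where
  single: "b \<in> carrier G1 - i1 ` carrier Z \<Longrightarrow> [Inr b] \<in> core"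
| step: "b \<in> carrier G1 - i1 ` carrier Z \<Longrightarrow> a \<in> carrier G0 - i0 ` carrier Z \<Longrightarrow> u \<in> core \<Longrightarrow>
    Inr b # Inl a # u \<in> core"

lemma core_words: "u \<in> core \<Longrightarrow> u \<in> W"
  by (induction rule: core.induct) auto

lemma core_join:
  assumes "u \<in> core" and "a \<in> carrier G0 - i0 ` carrier Z" and "v \<in> core"
  shows "u @ Inl a # v \<in> core"
  using assms by (induction rule: core.induct) (auto intro: core.intros)

text \<open>
  Ping-pong on normal forms: let \<open>A\<close> be those starting in \<open>G1\<close>, and \<open>B\<close> the others. Letters of
  \<open>G1\<close> outside \<open>Z\<close> map \<open>B\<close> into \<open>A\<close>, and letters of \<open>G0\<close> outside \<open>Z\<close> map \<open>A\<close> into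
  \<open>B\<close>, so a core maps \<open>B\<close> into \<open>A\<close>. The whole of \<open>G0\<close> keeps the trivial normal form in \<open>B\<close>.
\<close>

lemma core_class_notin_in0:
  assumes u: "u \<in> core"
  shows "R `` {u} \<notin> in0 ` carrier G0"
proof
  assume "R `` {u} \<in> in0 ` carrier G0"
  then obtain a where a: "a \<in> carrier G0" "R `` {u} = R `` {[Inl a]}"
    by (auto simp: amalg_in0_def)
  then have rel: "(u, [Inl a]) \<in> R"
    using eq_equiv_class_iff[OF equiv_rel, of u "[Inl a]"] core_words[OF u] by simp
  obtain p0 where p0: "\<And>x. x \<in> carrier G0 \<Longrightarrow> p0 x \<in> carrier Z"
    "\<And>z x. z \<in> carrier Z \<Longrightarrow> x \<in> carrier G0 \<Longrightarrow> p0 (i0 z \<otimes>\<^bsub>G0\<^esub> x) = z \<otimes>\<^bsub>Z\<^esub> p0 x"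
    "p0 \<one>\<^bsub>G0\<^esub> = \<one>\<^bsub>Z\<^esub>"
    using G0.ex_normalized_projection[OF Z.group_axioms mon0] by blast
  obtain p1 where p1: "\<And>x. x \<in> carrier G1 \<Longrightarrow> p1 x \<in> carrier Z"
    "\<And>z x. z \<in> carrier Z \<Longrightarrow> x \<in> carrier G1 \<Longrightarrow> p1 (i1 z \<otimes>\<^bsub>G1\<^esub> x) = z \<otimes>\<^bsub>Z\<^esub> p1 x"
    "p1 \<one>\<^bsub>G1\<^esub> = \<one>\<^bsub>Z\<^esub>"
    using G1.ex_normalized_projection[OF Z.group_axioms mon1] by blast
  define rep where "rep = case_sum (\<lambda>t. t \<in> carrier G0 \<and> p0 t = \<one>\<^bsub>Z\<^esub> \<and> t \<noteq> \<one>\<^bsub>G0\<^esub>)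
    (\<lambda>t. t \<in> carrier G1 \<and> p1 t = \<one>\<^bsub>Z\<^esub> \<and> t \<noteq> \<one>\<^bsub>G1\<^esub>)"
  define N where "N = {l. list_all rep l \<and> successively (\<lambda>x y. isl x \<noteq> isl y) l}"
  define S where "S = carrier Z \<times> N"
  have N0: "Inl t # l \<in> N \<longleftrightarrow>
      t \<in> carrier G0 \<and> p0 t = \<one>\<^bsub>Z\<^esub> \<and> t \<noteq> \<one>\<^bsub>G0\<^esub> \<and> l \<in> N \<and> \<not> starts_with Inl l" for t l
    by (cases l; cases "hd l") (auto simp: N_def rep_def)
  have N1: "Inr t # l \<in> N \<longleftrightarrow>
      t \<in> carrier G1 \<and> p1 t = \<one>\<^bsub>Z\<^esub> \<and> t \<noteq> \<one>\<^bsub>G1\<^esub> \<and> l \<in> N \<and> \<not> starts_with Inr l" for t l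
    by (cases l; cases "hd l") (auto simp: N_def rep_def)
  obtain g0 where g0: "\<And>x q. x \<in> carrier G0 \<Longrightarrow> q \<in> S \<Longrightarrow> g0 x q \<in> S"
    "\<And>x y q. x \<in> carrier G0 \<Longrightarrow> y \<in> carrier G0 \<Longrightarrow> q \<in> S \<Longrightarrow> g0 (x \<otimes>\<^bsub>G0\<^esub> y) q = g0 x (g0 y q)"
    "\<And>z y l. z \<in> carrier Z \<Longrightarrow> y \<in> carrier Z \<Longrightarrow> l \<in> N \<Longrightarrow> g0 (i0 z) (y, l) = (z \<otimes>\<^bsub>Z\<^esub> y, l)"
    "\<And>x q. x \<in> carrier G0 - i0 ` carrier Z \<Longrightarrow> q \<in> S \<Longrightarrow> \<not> starts_with Inl (snd q) \<Longrightarrow>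
      starts_with Inl (snd (g0 x q))"
    using G0.normal_form_action[OF Z.group_axioms mon0 p0 inj_Inl N0] unfolding S_def by blast
  obtain g1 where g1: "\<And>x q. x \<in> carrier G1 \<Longrightarrow> q \<in> S \<Longrightarrow> g1 x q \<in> S"
    "\<And>x y q. x \<in> carrier G1 \<Longrightarrow> y \<in> carrier G1 \<Longrightarrow> q \<in> S \<Longrightarrow> g1 (x \<otimes>\<^bsub>G1\<^esub> y) q = g1 x (g1 y q)"
    "\<And>z y l. z \<in> carrier Z \<Longrightarrow> y \<in> carrier Z \<Longrightarrow> l \<in> N \<Longrightarrow> g1 (i1 z) (y, l) = (z \<otimes>\<^bsub>Z\<^esub> y, l)"
    "\<And>x q. x \<in> carrier G1 - i1 ` carrier Z \<Longrightarrow> q \<in> S \<Longrightarrow> \<not> starts_with Inr (snd q) \<Longrightarrow>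
      starts_with Inr (snd (g1 x q))"
    using G1.normal_form_action[OF Z.group_axioms mon1 p1 inj_Inr N1] unfolding S_def by blast
  have g0_one: "g0 \<one>\<^bsub>G0\<^esub> q = q" and g1_one: "g1 \<one>\<^bsub>G1\<^esub> q = q" if "q \<in> S" for q
    using that g0(3)[of "\<one>\<^bsub>Z\<^esub>" "fst q" "snd q"] g1(3)[of "\<one>\<^bsub>Z\<^esub>" "fst q" "snd q"]
    by (auto simp: S_def)
  have agree: "g0 (i0 z) q = g1 (i1 z) q" if "z \<in> carrier Z" "q \<in> S" for z q
    using that by (auto simp: S_def g0 g1)
  define act where "act = foldr (case_sum g0 g1)"
  have act_simps [simp]: "act [] q = q" "act (Inl a # w) q = g0 a (act w q)"
    "act (Inr b # w) q = g1 b (act w q)" "act (v @ w) q = act v (act w q)" for a b v w q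
    by (simp_all add: act_def)
  have act_closed: "act w q \<in> S" if "w \<in> W" "q \<in> S" for w q
    using that
  proof (induction w)
    case (Cons x w)
    then show ?case by (cases x) (auto intro: g0 g1)
  qed simp
  have act_rel: "\<forall>q\<in>S. act v q = act w q" if "(v, w) \<in> R" for v w
    using that
  proof (induction rule: amalg_rel.induct)
    case (append v v' w w')
    then show ?case by (auto dest!: rel_words intro: act_closed)
  qed (auto simp: g0_one g1_one g0(2) g1(2) agree)
  have disj: "\<not> starts_with Inl l" if "starts_with Inr l" for l :: "('a + 'b) list"
    using that by (auto simp: starts_with_def)
  have ping_pong: "starts_with Inr (snd (act u q))"
    if "u \<in> core" "q \<in> S" "\<not> starts_with Inr (snd q)" for u q
    using that
  proof (induction rule: core.induct)
    case (step b a u)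
    then have uq: "act u q \<in> S" by (intro act_closed core_words)
    have "starts_with Inl (snd (g0 a (act u q)))"
      using step uq by (intro g0(4) disj) auto
    then show ?case
      using step uq disj by (auto intro!: g1(4) g0(1))
  qed (auto intro: g1(4))
  \<comment> \<open>the trivial normal form, on which \<open>u\<close> and \<open>a\<close> act differently\<close>
  have q0: "(\<one>\<^bsub>Z\<^esub>, []) \<in> S" by (simp add: S_def N_def)
  have "\<not> starts_with Inr (snd (g0 a (\<one>\<^bsub>Z\<^esub>, [])))"
  proof (cases "a \<in> i0 ` carrier Z")
    case True
    then show ?thesis by (auto simp: g0(3) N_def)
  next
    case False
    then have "starts_with Inl (snd (g0 a (\<one>\<^bsub>Z\<^esub>, [])))"
      using a q0 by (intro g0(4)) auto
    then show ?thesis using disj by blast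
  qed
  moreover have "act u (\<one>\<^bsub>Z\<^esub>, []) = g0 a (\<one>\<^bsub>Z\<^esub>, [])"
    using act_rel[OF rel] q0 by simp
  ultimately show False using ping_pong[OF u q0] by simp
qed

definition has_core :: "('a + 'b) list set \<Rightarrow> bool" where
  "has_core A \<longleftrightarrow> (\<exists>a\<in>carrier G0. \<exists>u\<in>core. \<exists>a'\<in>carrier G0. A = R `` {Inl a # u @ [Inl a']})"

lemma has_core_notin_in0:
  assumes "has_core A"
  shows "A \<notin> in0 ` carrier G0"
proof
  assume A_in: "A \<in> in0 ` carrier G0"
  interpret P: group P by (rule group_P)
  interpret H: subgroup "in0 ` carrier G0" P by (rule subgroup_in0)
  obtain a u a' where a: "a \<in> carrier G0" "a' \<in> carrier G0" and u: "u \<in> core"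
    and A: "A = R `` {Inl a # u @ [Inl a']}"
    using assms by (auto simp: has_core_def)
  have in0: "in0 a \<in> in0 ` carrier G0" "in0 a' \<in> in0 ` carrier G0"
    using a by auto
  then have closed: "in0 a \<in> carrier P" "in0 a' \<in> carrier P" "R `` {u} \<in> carrier P"
    using H.subset core_words[OF u] by (auto intro: class_in_P)
  have "A = in0 a \<otimes>\<^bsub>P\<^esub> R `` {u} \<otimes>\<^bsub>P\<^esub> in0 a'"
    using a core_words[OF u] by (simp add: A amalg_in0_def mult_P)
  then have "R `` {u} = inv\<^bsub>P\<^esub> in0 a \<otimes>\<^bsub>P\<^esub> A \<otimes>\<^bsub>P\<^esub> inv\<^bsub>P\<^esub> in0 a'"
    using closed by (simp add: P.m_assoc) (simp add: P.m_assoc[symmetric])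
  then have "R `` {u} \<in> in0 ` carrier G0"
    using in0 A_in by auto
  then show False using core_class_notin_in0[OF u] by blast
qed

section \<open>Reduction of arbitrary words\<close>

lemma class_cons:
  assumes "R `` {v} = R `` {w}" and "v \<in> W" and "w \<in> W" and "[x] \<in> W"
  shows "R `` {x # v} = R `` {x # w}"
  using mult_P[of "[x]" v] mult_P[of "[x]" w] assms by simp

lemma rewrite_head: "(v, v') \<in> R \<Longrightarrow> w \<in> W \<Longrightarrow> R `` {v @ w} = R `` {v' @ w}"
  by (intro class_eq amalg_rel.append amalg_rel.refl)

lemma class_simps:
  assumes "w \<in> W"
  shows "R `` {Inl \<one>\<^bsub>G0\<^esub> # w} = R `` {w}"
    and "a \<in> carrier G0 \<Longrightarrow> a' \<in> carrier G0 \<Longrightarrow>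
      R `` {Inl a # Inl a' # w} = R `` {Inl (a \<otimes>\<^bsub>G0\<^esub> a') # w}"
    and "b \<in> carrier G1 \<Longrightarrow> b' \<in> carrier G1 \<Longrightarrow>
      R `` {Inr b # Inr b' # w} = R `` {Inr (b \<otimes>\<^bsub>G1\<^esub> b') # w}"
    and "z \<in> carrier Z \<Longrightarrow> R `` {Inr (i1 z) # w} = R `` {Inl (i0 z) # w}"
proof -
  show "R `` {Inl \<one>\<^bsub>G0\<^esub> # w} = R `` {w}"
    using rewrite_head[OF amalg_rel.one0 assms] by simp
  show "R `` {Inl a # Inl a' # w} = R `` {Inl (a \<otimes>\<^bsub>G0\<^esub> a') # w}"
    if "a \<in> carrier G0" "a' \<in> carrier G0"
    using rewrite_head[OF amalg_rel.mult0[OF that] assms] by simp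
  show "R `` {Inr b # Inr b' # w} = R `` {Inr (b \<otimes>\<^bsub>G1\<^esub> b') # w}"
    if "b \<in> carrier G1" "b' \<in> carrier G1"
    using rewrite_head[OF amalg_rel.mult1[OF that] assms] by simp
  show "R `` {Inr (i1 z) # w} = R `` {Inl (i0 z) # w}" if "z \<in> carrier Z"
    using rewrite_head[OF amalg_rel.glue[OF that] assms] by simp
qed

definition has_reduced_form :: "('a + 'b) list \<Rightarrow> bool" where
  "has_reduced_form w \<longleftrightarrow> R `` {w} \<in> in0 ` carrier G0 \<or> has_core (R `` {w})"

lemma has_reduced_form_cases:
  assumes "has_reduced_form w"
  obtains a where "a \<in> carrier G0" "R `` {w} = R `` {[Inl a]}"
  | a u a' where "a \<in> carrier G0" "u \<in> core" "a' \<in> carrier G0" "R `` {w} = R `` {Inl a # u @ [Inl a']}"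
  using assms by (auto simp: has_reduced_form_def has_core_def amalg_in0_def)

lemma reduced_form_single: "a \<in> carrier G0 \<Longrightarrow> has_reduced_form [Inl a]"
  by (auto simp: has_reduced_form_def amalg_in0_def)

lemma reduced_form_core:
  "a \<in> carrier G0 \<Longrightarrow> u \<in> core \<Longrightarrow> a' \<in> carrier G0 \<Longrightarrow> has_reduced_form (Inl a # u @ [Inl a'])"
  by (auto simp: has_reduced_form_def has_core_def)

lemma reduced_form_core_Inl:
  assumes "u \<in> core" "a \<in> carrier G0"
  shows "has_reduced_form (u @ [Inl a])"
  using reduced_form_core[of "\<one>\<^bsub>G0\<^esub>" u a] class_simps(1)[of "u @ [Inl a]"] assms core_words[of u]
  by (simp add: has_reduced_form_def)

text \<open>
  Every word has a reduced form, by induction over its letters from the right. A new letter of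
  \<open>G0\<close> merges with the leading letter of the reduced form.
\<close>

lemma reduced_form_Inl:
  assumes "has_reduced_form w" and w: "w \<in> W" and c: "c \<in> carrier G0"
  shows "has_reduced_form (Inl c # w)"
  using assms(1)
proof (cases rule: has_reduced_form_cases)
  case (1 a)
  then have "R `` {Inl c # w} = R `` {[Inl (c \<otimes>\<^bsub>G0\<^esub> a)]}"
    using class_cons[OF 1(2), of "Inl c"] w c by (simp add: class_simps)
  with 1 c reduced_form_single[of "c \<otimes>\<^bsub>G0\<^esub> a"] show ?thesis
    by (simp add: has_reduced_form_def)
next
  case (2 a u a')
  then have "R `` {Inl c # w} = R `` {Inl (c \<otimes>\<^bsub>G0\<^esub> a) # u @ [Inl a']}"
    using class_cons[OF 2(4), of "Inl c"] w c core_words[of u] by (simp add: class_simps)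
  with 2 c reduced_form_core[of "c \<otimes>\<^bsub>G0\<^esub> a" u a'] show ?thesis
    by (simp add: has_reduced_form_def)
qed

lemma reduced_form_glue:
  assumes "has_reduced_form w" and "w \<in> W" and "b \<in> i1 ` carrier Z"
  shows "has_reduced_form (Inr b # w)"
proof -
  obtain z where z: "z \<in> carrier Z" "b = i1 z" using assms(3) by blast
  then have "R `` {Inr b # w} = R `` {Inl (i0 z) # w}" using assms(2) by (simp add: class_simps)
  then show ?thesis using reduced_form_Inl[OF assms(1,2)] z by (simp add: has_reduced_form_def)
qed

lemma reduced_form_Inr_single:
  assumes "b \<in> carrier G1" and "a \<in> carrier G0"
  shows "has_reduced_form [Inr b, Inl a]"
  using assms reduced_form_glue[of "[Inl a]" b] reduced_form_single[of a]
    reduced_form_core_Inl[OF core.single[of b], of a]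
  by (cases "b \<in> i1 ` carrier Z") auto

lemma reduced_form_Inr_core:
  assumes "b \<in> carrier G1" and "a \<in> carrier G0 - i0 ` carrier Z" and "u \<in> core" and "a' \<in> carrier G0"
  shows "has_reduced_form (Inr b # Inl a # u @ [Inl a'])"
  using assms reduced_form_glue[of "Inl a # u @ [Inl a']" b] reduced_form_core[of a u a']
    reduced_form_core_Inl[OF core.step[of b a u], of a'] core_words[of u]
  by (cases "b \<in> i1 ` carrier Z") auto

text \<open>
  A new letter \<open>b\<close> of \<open>G1\<close> in front of \<open>a u a'\<close> extends the core unless \<open>a\<close> lies in \<open>Z\<close>. In
  that case \<open>b a\<close> merges with the first letter of \<open>u\<close>. The cascade ends there, because the next
  letter of \<open>u\<close>, if any, is outside \<open>Z\<close>.
\<close>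

lemma reduced_form_Inr:
  assumes "has_reduced_form w" and w: "w \<in> W" and b: "b \<in> carrier G1"
  shows "has_reduced_form (Inr b # w)"
  using assms(1)
proof (cases rule: has_reduced_form_cases)
  case (1 a)
  then have "R `` {Inr b # w} = R `` {[Inr b, Inl a]}"
    using w b by (intro class_cons) auto
  with 1 b show ?thesis using reduced_form_Inr_single by (simp add: has_reduced_form_def)
next
  case (2 a u a')
  have u: "u @ [Inl a'] \<in> W" using 2 core_words by simp
  have eq: "R `` {Inr b # w} = R `` {Inr b # Inl a # u @ [Inl a']}"
    using 2 w b u by (intro class_cons) auto
  show ?thesis
  proof (cases "a \<in> i0 ` carrier Z")
    case False
    then show ?thesis using eq 2 b reduced_form_Inr_core by (simp add: has_reduced_form_def)
  next
    case True
    then obtain z where z: "z \<in> carrier Z" "a = i0 z" by blast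
    define d where "d = b \<otimes>\<^bsub>G1\<^esub> i1 z"
    have d: "d \<in> carrier G1" using b z by (simp add: d_def)
    have "R `` {Inr b # Inl a # u @ [Inl a']} = R `` {Inr b # Inr (i1 z) # u @ [Inl a']}"
      using z b u by (intro class_cons) (auto simp: class_simps)
    then have eq': "R `` {Inr b # w} = R `` {Inr d # u @ [Inl a']}"
      using z b u eq by (simp add: class_simps d_def)
    from \<open>u \<in> core\<close> show ?thesis
    proof cases
      case (single e)
      then have "R `` {Inr b # w} = R `` {[Inr (d \<otimes>\<^bsub>G1\<^esub> e), Inl a']}"
        using eq' d 2 by (simp add: class_simps)
      then show ?thesis
        using reduced_form_Inr_single[of "d \<otimes>\<^bsub>G1\<^esub> e" a'] single d 2 by (simp add: has_reduced_form_def)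
    next
      case (step e c v)
      then have "R `` {Inr b # w} = R `` {Inr (d \<otimes>\<^bsub>G1\<^esub> e) # Inl c # v @ [Inl a']}"
        using eq' d 2 core_words[of v] by (simp add: class_simps)
      then show ?thesis
        using reduced_form_Inr_core[of "d \<otimes>\<^bsub>G1\<^esub> e" c v a'] step d 2 by (simp add: has_reduced_form_def)
    qed
  qed
qed

lemma reduced_form_word: "w \<in> W \<Longrightarrow> has_reduced_form w"
proof (induction w)
  case Nil
  have "R `` {[]} = R `` {[Inl \<one>\<^bsub>G0\<^esub>]}" by (simp add: class_simps)
  then show ?case using reduced_form_single[of "\<one>\<^bsub>G0\<^esub>"] by (simp add: has_reduced_form_def)
next
  case (Cons x w)
  then show ?case by (cases x) (auto intro: reduced_form_Inl reduced_form_Inr)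
qed

lemma has_core_if_notin_in0: "A \<in> carrier P - in0 ` carrier G0 \<Longrightarrow> has_core A"
  using reduced_form_word by (auto elim!: P_cases simp: has_reduced_form_def)

section \<open>Condition (ST)\<close>

text \<open>
  With \<open>A = a u a'\<close> and \<open>B = c v c'\<close>, a return to \<open>G0\<close> forces \<open>a' x c\<close> into \<open>Z\<close>, since
  otherwise the two cores join.
\<close>

lemma finite_return_set:
  assumes "finite (carrier Z)" and A: "has_core A" and B: "has_core B"
  shows "finite {x \<in> carrier G0. A \<otimes>\<^bsub>P\<^esub> in0 x \<otimes>\<^bsub>P\<^esub> B \<in> in0 ` carrier G0}"
proof -
  obtain a u a' where a: "a \<in> carrier G0" "a' \<in> carrier G0" "u \<in> core"
    "A = R `` {Inl a # u @ [Inl a']}"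
    using A by (auto simp: has_core_def)
  obtain c v c' where c: "c \<in> carrier G0" "c' \<in> carrier G0" "v \<in> core"
    "B = R `` {Inl c # v @ [Inl c']}"
    using B by (auto simp: has_core_def)
  have "x \<in> (\<lambda>z. inv\<^bsub>G0\<^esub> a' \<otimes>\<^bsub>G0\<^esub> i0 z \<otimes>\<^bsub>G0\<^esub> inv\<^bsub>G0\<^esub> c) ` carrier Z"
    if x: "x \<in> carrier G0" and ret: "A \<otimes>\<^bsub>P\<^esub> in0 x \<otimes>\<^bsub>P\<^esub> B \<in> in0 ` carrier G0" for x
  proof -
    define y where "y = a' \<otimes>\<^bsub>G0\<^esub> x \<otimes>\<^bsub>G0\<^esub> c"
    have y: "y \<in> carrier G0" using a c x by (simp add: y_def)
    have mid: "R `` {[Inl a', Inl x, Inl c]} = R `` {[Inl y]}"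
      using a c x by (simp add: class_simps y_def)
    have "A \<otimes>\<^bsub>P\<^esub> in0 x \<otimes>\<^bsub>P\<^esub> B
        = R `` {Inl a # u} \<otimes>\<^bsub>P\<^esub> R `` {[Inl a', Inl x, Inl c]} \<otimes>\<^bsub>P\<^esub> R `` {v @ [Inl c']}"
      using a c x core_words by (simp add: amalg_in0_def mult_P)
    also have "\<dots> = R `` {Inl a # (u @ Inl y # v) @ [Inl c']}"
      using a c x y core_words by (simp add: mid mult_P)
    finally have "\<not> has_core (R `` {Inl a # (u @ Inl y # v) @ [Inl c']})"
      using ret has_core_notin_in0 by auto
    then have "y \<in> i0 ` carrier Z"
      using core_join[of u y v] a c y unfolding has_core_def by blast
    then obtain z where z: "z \<in> carrier Z" "y = i0 z" by blast
    have "x = inv\<^bsub>G0\<^esub> a' \<otimes>\<^bsub>G0\<^esub> y \<otimes>\<^bsub>G0\<^esub> inv\<^bsub>G0\<^esub> c"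
      using a c x by (simp add: y_def G0.m_assoc) (simp add: G0.m_assoc[symmetric])
    with z show ?thesis by blast
  qed
  then show ?thesis
    by (intro finite_subset[OF _ finite_imageI[OF assms(1)]]) blast
qed

theorem condition_ST_amalg:
  assumes "finite (carrier Z)"
  shows "condition_ST P (in0 ` carrier G0)"
  unfolding condition_ST_def
proof (intro allI impI, elim conjE)
  fix C assume C: "finite C" "C \<subseteq> carrier P - in0 ` carrier G0"
  define F where "F = (\<Union>g\<in>C. \<Union>h\<in>C.
    {x \<in> carrier G0. g \<otimes>\<^bsub>P\<^esub> in0 x \<otimes>\<^bsub>P\<^esub> h \<in> in0 ` carrier G0})"
  have "finite F"
    unfolding F_def using C has_core_if_notin_in0
    by (intro finite_UN_I finite_return_set[OF assms]) auto
  then show "\<exists>E. finite E \<and> E \<subseteq> in0 ` carrier G0 \<and> (\<forall>g0\<in>in0 ` carrier G0 - E.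
      \<forall>g\<in>C. \<forall>h\<in>C. g \<otimes>\<^bsub>P\<^esub> g0 \<otimes>\<^bsub>P\<^esub> h \<notin> in0 ` carrier G0)"
    by (intro exI[of _ "in0 ` F"]) (auto simp: F_def)
qed

end

theorem proposition4p1:
  fixes G0 :: "('a, 'm) monoid_scheme" and G1 :: "('b, 'n) monoid_scheme"
    and Z :: "('z, 'k) monoid_scheme" and i0 :: "'z \<Rightarrow> 'a" and i1 :: "'z \<Rightarrow> 'b"
  assumes "comm_group G0" and "infinite (carrier G0)"
    and "group G1"
    and "group Z" and "finite (carrier Z)"
    and "i0 \<in> mon Z G0" and "i1 \<in> mon Z G1"
    and "i1 ` carrier Z \<noteq> carrier G1"
  shows "condition_ST (amalg G0 G1 Z i0 i1) (amalg_in0 G0 G1 Z i0 i1 ` carrier G0)"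
proof -
  interpret amalg_data G0 G1 Z i0 i1
    using assms by (simp add: amalg_data_def amalg_data_axioms_def comm_group.axioms(2))
  show ?thesis using assms by (intro condition_ST_amalg)
qed

end
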